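(* Let $X$ be a Banach space with the Daugavet property, let $\varepsilon>0$ and let $S$ be a Lip-slice of $S_X$. Then for every $x\in S_X$ there is $y\in S$ such that $\|x+y\|>2-\varepsilon$.
   Context: $X$ is a real or complex Banach space, $S_X$ its unit sphere, $L(X)$ the bounded linear operators on $X$. $X$ has the Daugavet property if every rank-one operator $T\in L(X)$ satisfies $\|\mathrm{Id}+T\|=1+\|T\|$. A Lip-slice of $S_X$ is a non-empty set of the form $$\left\{\frac{x_1-x_2}{\|x_1-x_2\|} : x_1,x_2\in X,\ x_1\neq x_2,\ \frac{f(x_1)-f(x_2)}{\|x_1-x_2\|}>\alpha\right\},$$ where $\alpha\in\mathbb{R}$ and $f:X\to\mathbb{R}$ is a Lipschitz function (not necessarily linear) that is non-zero in $\operatorname{Lip}(X,\mathbb{R})$, i.e. non-constant. *)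

theory Defs
  imports "HOL-Analysis.Analysis"
begin

text \<open>
  The library has no type class of complex normed spaces.  A (real or complex) Banach space is
  therefore a type of class \<^class>\<open>banach\<close> together with a scalar multiplication \<open>s\<close> over the
  ground field \<open>'k\<close> that is compatible with the norm and extends the real scalar multiplication.
  Only \<open>'k = real\<close>, where \<open>s\<close> is necessarily \<^const>\<open>scaleR\<close>, and \<open>'k = complex\<close> matter.
\<close>

locale banach_over = vector_space s
  for s :: "'k::real_normed_field \<Rightarrow> 'a::banach \<Rightarrow> 'a" +
  assumes norm_scale: "norm (s c x) = norm c * norm x"
    and scale_of_real: "s (of_real r) x = r *\<^sub>R x"

lemma banach_over_scaleR: "banach_over (scaleR :: real \<Rightarrow> 'a::banach \<Rightarrow> 'a)"
  by unfold_locales (simp_all add: algebra_simps)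

lemma banach_over_complex: "banach_over ((*) :: complex \<Rightarrow> complex \<Rightarrow> complex)"
  by unfold_locales (simp_all add: algebra_simps norm_mult scaleR_conv_of_real)

definition bounded_operator ::
    "('k::real_normed_field \<Rightarrow> 'a::banach \<Rightarrow> 'a) \<Rightarrow> ('a \<Rightarrow> 'a) \<Rightarrow> bool" where
  "bounded_operator s T \<longleftrightarrow> Vector_Spaces.linear s s T \<and> (\<exists>K. \<forall>x. norm (T x) \<le> K * norm x)"

definition rank_one :: "('k::real_normed_field \<Rightarrow> 'a::banach \<Rightarrow> 'a) \<Rightarrow> ('a \<Rightarrow> 'a) \<Rightarrow> bool" where
  "rank_one s T \<longleftrightarrow> vector_space.dim s (range T) = 1"

definition daugavet_property :: "('k::real_normed_field \<Rightarrow> 'a::banach \<Rightarrow> 'a) \<Rightarrow> bool" where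
  "daugavet_property s \<longleftrightarrow>
     (\<forall>T. bounded_operator s T \<and> rank_one s T \<longrightarrow> onorm (\<lambda>x. x + T x) = 1 + onorm T)"

definition lip_slice :: "'a::banach set \<Rightarrow> bool" where
  "lip_slice S \<longleftrightarrow> S \<noteq> {} \<and>
     (\<exists>(f :: 'a \<Rightarrow> real) \<alpha>. (\<exists>L. L-lipschitz_on UNIV f) \<and> \<not> (\<exists>c. \<forall>x. f x = c) \<and>
        S = {(x1 - x2) /\<^sub>R norm (x1 - x2) | x1 x2.
               x1 \<noteq> x2 \<and> (f x1 - f x2) / norm (x1 - x2) > \<alpha>})"

end

theory Submission
  imports Defs
begin

text \<open>
  Let \<open>f\<close> be a Lipschitz function defining the Lip-slice \<open>S\<close> at level \<open>\<alpha>\<close>.  The supremum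
  \<open>q z\<close> of \<open>(f (x + t z) - f x) / t\<close> over all \<open>x\<close> and \<open>t > 0\<close> is sublinear in \<open>z\<close> and
  dominated by a multiple of the norm, and a unit vector \<open>y\<close> with \<open>q y > \<alpha>\<close> lies in \<open>S\<close>.  By
  the Hahn-Banach theorem there is a linear \<open>g \<le> q\<close> that agrees with \<open>q\<close> at a given vector
  whose direction lies in \<open>S\<close>; hence \<open>S\<close> contains the non-empty slice \<open>{g > \<alpha>}\<close> of the
  sphere.  For a linear slice, the Daugavet equation for the rank-one operator given by
  \<open>g / \<parallel>g\<parallel>\<close> (or its complexification) and \<open>x\<close> provides the required point.
\<close>

section \<open>Sublinear functionals and the Hahn-Banach theorem\<close>

definition sublinear :: "('a::real_vector \<Rightarrow> real) \<Rightarrow> bool" where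
  "sublinear q \<longleftrightarrow> (\<forall>x y. q (x + y) \<le> q x + q y) \<and> (\<forall>t>0. \<forall>x. q (t *\<^sub>R x) \<le> t * q x)"

lemma sublinearI:
  assumes "\<And>x y. q (x + y) \<le> q x + q y" "\<And>t x. 0 < t \<Longrightarrow> q (t *\<^sub>R x) \<le> t * q x"
  shows "sublinear q"
  using assms by (simp add: sublinear_def)

lemma sublinear_add: "sublinear q \<Longrightarrow> q (x + y) \<le> q x + q y"
  by (simp add: sublinear_def)

lemma sublinear_scaleR:
  assumes "sublinear q" "0 < t"
  shows "q (t *\<^sub>R x) = t * q x"
proof (rule antisym)
  show "q (t *\<^sub>R x) \<le> t * q x"
    using assms by (simp add: sublinear_def)
  have "q (inverse t *\<^sub>R (t *\<^sub>R x)) \<le> inverse t * q (t *\<^sub>R x)"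
    using assms unfolding sublinear_def by (metis positive_imp_inverse_positive)
  then show "t * q x \<le> q (t *\<^sub>R x)"
    using assms(2) by (simp add: field_simps)
qed

lemma sublinear_zero: "sublinear q \<Longrightarrow> q 0 = 0"
  using sublinear_scaleR[of q 2 0] by simp

lemma sublinear_scaleR_nonneg: "sublinear q \<Longrightarrow> 0 \<le> t \<Longrightarrow> q (t *\<^sub>R x) = t * q x"
  by (cases "t = 0") (auto simp: sublinear_zero sublinear_scaleR)

lemma sublinear_uminus: "sublinear q \<Longrightarrow> - q (- x) \<le> q x"
  using sublinear_add[of q x "- x"] by (simp add: sublinear_zero)

text \<open>At \<open>x = - y\<close> the last bound reads \<open>r (- y) \<le> - q y\<close>, so
  every linear functional below \<open>r\<close> takes at least the value \<open>q y\<close> at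
  \<open>y\<close>. The witness is the infimum of \<open>q (x + t y) - t q y\<close> over
  \<open>t \<ge> 0\<close>.\<close>

lemma sublinear_descend:
  fixes q :: "'a::real_vector \<Rightarrow> real"
  assumes q: "sublinear q"
  obtains r where "sublinear r" "r \<le> q" "\<And>x. r x \<le> q (x + y) - q y"
proof -
  define F where "F x t = q (x + t *\<^sub>R y) - t * q y" for x t
  define r where "r x = (INF t\<in>{0..}. F x t)" for x
  \<comment> \<open>Subadditivity for \<open>t y = (x + t y) + (- x)\<close> keeps the infimum
    finite.\<close>
  have lower: "- q (- x) \<le> F x t" if "0 \<le> t" for x t
    using sublinear_add[OF q, of "x + t *\<^sub>R y" "- x"] that
    by (simp add: F_def sublinear_scaleR_nonneg[OF q])
  have bdd: "bdd_below (F x ` {0..})" for x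
    using lower by (intro bdd_belowI2) auto
  have r_le: "r x \<le> F x t" if "0 \<le> t" for x t
    unfolding r_def using that by (intro cINF_lower bdd) auto
  have r_ge: "b \<le> r x" if "\<And>t. 0 \<le> t \<Longrightarrow> b \<le> F x t" for b x
    unfolding r_def using that by (intro cINF_greatest) auto
  have add: "r (x + z) \<le> r x + r z" for x z
  proof -
    have *: "r (x + z) \<le> F x t + F z u" if "0 \<le> t" "0 \<le> u" for t u
    proof -
      have "r (x + z) \<le> F (x + z) (t + u)"
        using that by (intro r_le) auto
      also have "\<dots> \<le> F x t + F z u"
        using sublinear_add[OF q, of "x + t *\<^sub>R y" "z + u *\<^sub>R y"]
        by (simp add: F_def algebra_simps)
      finally show ?thesis .
    qed
    \<comment> \<open>The parameters are independent, so the infimum is taken first over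
      \<open>t\<close>, then over \<open>u\<close>.\<close>
    have "r (x + z) - F z u \<le> r x" if "0 \<le> u" for u
      using *[OF _ that] by (intro r_ge) (auto simp: algebra_simps)
    then have "r (x + z) - r x \<le> r z"
      by (intro r_ge) (auto simp: algebra_simps)
    then show ?thesis by simp
  qed
  have scale: "r (s *\<^sub>R x) \<le> s * r x" if s: "0 < s" for s x
  proof -
    have "r (s *\<^sub>R x) / s \<le> F x t" if "0 \<le> t" for t
    proof -
      have "r (s *\<^sub>R x) \<le> F (s *\<^sub>R x) (s * t)"
        using that s by (intro r_le) auto
      also have "\<dots> = s * F x t"
        using sublinear_scaleR[OF q s, of "x + t *\<^sub>R y"] by (simp add: F_def algebra_simps)
      finally show ?thesis using s by (simp add: field_simps)
    qed
    then have "r (s *\<^sub>R x) / s \<le> r x" by (rule r_ge)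
    then show ?thesis using s by (simp add: field_simps)
  qed
  show thesis
  proof
    show "sublinear r" by (rule sublinearI[OF add scale])
    show "r \<le> q"
      using r_le[of 0] by (auto simp: le_fun_def F_def)
    show "r x \<le> q (x + y) - q y" for x
      using r_le[of 1 x] by (simp add: F_def)
  qed
qed

text \<open>The pointwise infimum works: \<open>- p (- x)\<close> bounds all members from below at
  \<open>x\<close>, and subadditivity survives because the smaller of two members of a chain lies
  below both. This supplies the bounds that Zorn's lemma asks for.\<close>

lemma sublinear_INF_chain:
  fixes C :: "('a::real_vector \<Rightarrow> real) set"
  assumes ne: "C \<noteq> {}" and sub: "\<And>q. q \<in> C \<Longrightarrow> sublinear q \<and> q \<le> p"
    and chain: "\<And>q r. q \<in> C \<Longrightarrow> r \<in> C \<Longrightarrow> q \<le> r \<or> r \<le> q"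
  obtains m where "sublinear m" "\<And>q. q \<in> C \<Longrightarrow> m \<le> q"
proof -
  define m where "m x = (INF q\<in>C. q x)" for x
  have "- p (- x) \<le> q x" if "q \<in> C" for q x
    using sublinear_uminus[of q x] sub[OF that] by (force simp: le_fun_def dest: spec[of _ "- x"])
  then have bdd: "bdd_below ((\<lambda>q. q x) ` C)" for x
    by (intro bdd_belowI2) auto
  have m_le: "m x \<le> q x" if "q \<in> C" for q x
    unfolding m_def using that by (intro cINF_lower bdd)
  have m_ge: "b \<le> m x" if "\<And>q. q \<in> C \<Longrightarrow> b \<le> q x" for b x
    unfolding m_def using that ne by (intro cINF_greatest) auto
  have add: "m (x + y) \<le> m x + m y" for x y
  proof -
    have *: "m (x + y) \<le> q x + r y" if "q \<in> C" "r \<in> C" for q r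
    proof -
      have "\<exists>k\<in>C. k \<le> q \<and> k \<le> r"
        using chain[OF that] that by blast
      then obtain k where k: "k \<in> C" "k \<le> q" "k \<le> r" by blast
      have "m (x + y) \<le> k (x + y)" by (rule m_le[OF k(1)])
      also have "\<dots> \<le> k x + k y" using sub[OF k(1)] by (simp add: sublinear_add)
      also have "\<dots> \<le> q x + r y" using k by (intro add_mono) (auto simp: le_fun_def)
      finally show ?thesis .
    qed
    have "m (x + y) - r y \<le> m x" if "r \<in> C" for r
      using *[OF _ that] by (intro m_ge) (auto simp: algebra_simps)
    then have "m (x + y) - m x \<le> m y"
      by (intro m_ge) (auto simp: algebra_simps)
    then show ?thesis by simp
  qed
  have scale: "m (s *\<^sub>R x) \<le> s * m x" if s: "0 < s" for s x
  proof -
    have "m (s *\<^sub>R x) / s \<le> q x" if "q \<in> C" for q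
      using m_le[OF that, of "s *\<^sub>R x"] sub[OF that] s
      by (simp add: sublinear_scaleR field_simps)
    then have "m (s *\<^sub>R x) / s \<le> m x" by (rule m_ge)
    then show ?thesis using s by (simp add: field_simps)
  qed
  show thesis
    using that[OF sublinearI[OF add scale]] m_le by (auto simp: le_fun_def)
qed

text \<open>
  A sublinear functional that is minimal in the pointwise order is linear, since
  \<open>sublinear_descend\<close> cannot decrease it.
\<close>

lemma linear_le_sublinear:
  fixes p :: "'a::real_vector \<Rightarrow> real"
  assumes p: "sublinear p"
  obtains g where "linear g" "g \<le> p"
proof -
  define A where "A = {q. sublinear q \<and> q \<le> p}"
  \<comment> \<open>The order is reversed, so that the maximal element of Zorn's lemma is a minimal
    functional.\<close>
  have "\<exists>m\<in>A. \<forall>q\<in>A. m \<ge> q \<longrightarrow> q = m"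
  proof (rule predicate_Zorn)
    show "partial_order_on A (relation_of (\<ge>) A)"
      by (rule partial_order_on_relation_ofI) auto
    fix C assume C: "C \<in> Chains (relation_of (\<ge>) A)"
    show "\<exists>u\<in>A. \<forall>q\<in>C. q \<ge> u"
    proof (cases "C = {}")
      case True
      then show ?thesis using p by (auto simp: A_def)
    next
      case False
      have sub: "sublinear q \<and> q \<le> p" if "q \<in> C" for q
        using C that by (auto simp: Chains_def relation_of_def A_def)
      moreover have "q \<le> r \<or> r \<le> q" if "q \<in> C" "r \<in> C" for q r
        using C that by (auto simp: Chains_def relation_of_def)
      ultimately obtain m where m: "sublinear m" "\<And>q. q \<in> C \<Longrightarrow> m \<le> q"
        using sublinear_INF_chain[OF False] by metis
      have "m \<le> p"
        using False m(2) sub by (meson ex_in_conv order_trans)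
      with m show ?thesis by (auto simp: A_def)
    qed
  qed
  then obtain g where g: "sublinear g" "g \<le> p"
    and min: "\<And>q. sublinear q \<Longrightarrow> q \<le> g \<Longrightarrow> q = g"
    by (auto simp: A_def intro: order_trans)
  have add: "g (x + y) = g x + g y" for x y
  proof (rule antisym[OF sublinear_add[OF g(1)]])
    \<comment> \<open>By minimality \<open>r\<close> equals \<open>g\<close>, and the third property
      becomes superadditivity.\<close>
    obtain r where "sublinear r" "r \<le> g" "r x \<le> g (x + y) - g y"
      using sublinear_descend[OF g(1)] by metis
    then show "g x + g y \<le> g (x + y)" using min[of r] by simp
  qed
  have neg: "g (- x) = - g x" for x
    using add[of x "- x"] by (simp add: sublinear_zero[OF g(1)])
  have "g (t *\<^sub>R x) = t * g x" for t x
  proof (cases "0 \<le> t")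
    case False
    then show ?thesis
      using sublinear_scaleR[OF g(1), of "- t" x] neg[of "t *\<^sub>R x"] by simp
  qed (simp add: sublinear_scaleR_nonneg[OF g(1)])
  then have "linear g" using add by (intro linearI) auto
  with g(2) that show thesis by blast
qed

text \<open>The linear functional is taken below the lowered \<open>r\<close> of
  \<open>sublinear_descend\<close> rather than below \<open>p\<close> directly; since
  \<open>r (- y) \<le> - p y\<close>, its value at \<open>y\<close> is forced.\<close>

theorem hahn_banach_sublinear:
  fixes p :: "'a::real_vector \<Rightarrow> real"
  assumes p: "sublinear p"
  obtains g where "linear g" "\<And>x. g x \<le> p x" "g y = p y"
proof -
  obtain r where r: "sublinear r" "r \<le> p" "\<And>x. r x \<le> p (x + y) - p y"
    using sublinear_descend[OF p] by metis
  obtain g where g: "linear g" "g \<le> r"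
    using linear_le_sublinear[OF r(1)] .
  have le: "g x \<le> p x" for x
    using g(2) r(2) by (meson le_fun_def order_trans)
  have "g (- y) \<le> - p y"
    using g(2) r(3)[of "- y"] by (auto simp: sublinear_zero[OF p] le_fun_def intro: order_trans)
  then have "g y = p y"
    using le[of y] linear_neg[OF g(1), of y] by simp
  with g(1) le that show thesis by blast
qed

section \<open>Slices of the sphere inside Lip-slices\<close>

text \<open>This reduces the nonlinear problem to a linear slice; the vector \<open>u\<close>
  records that this slice is non-empty.\<close>

lemma lip_slice_contains_slice:
  fixes S :: "'a::banach set"
  assumes "lip_slice S"
  obtains g :: "'a \<Rightarrow> real" and \<alpha> u where "bounded_linear g" "norm u = 1" "\<alpha> < g u"
    "\<And>y. norm y = 1 \<Longrightarrow> \<alpha> < g y \<Longrightarrow> y \<in> S"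
proof -
  obtain f :: "'a \<Rightarrow> real" and \<alpha> L where L: "L-lipschitz_on UNIV f" and ne: "S \<noteq> {}"
    and S: "S = {(x1 - x2) /\<^sub>R norm (x1 - x2) | x1 x2.
               x1 \<noteq> x2 \<and> (f x1 - f x2) / norm (x1 - x2) > \<alpha>}"
    using assms unfolding lip_slice_def by blast
  obtain x1 x2 where x12: "x1 \<noteq> x2" "(f x1 - f x2) / norm (x1 - x2) > \<alpha>"
    using ne unfolding S by blast
  \<comment> \<open>\<open>w\<close> pairs a base point with a step length. Letting the base point
    range over the whole space is what makes the supremum \<open>q\<close> subadditive.\<close>
  define D where "D z w = (f (fst w + snd w *\<^sub>R z) - f (fst w)) / snd w" for z w
  define Q where "Q = (UNIV :: 'a set) \<times> {0::real<..}"
  define q where "q z = (SUP w\<in>Q. D z w)" for z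
  have Qne: "Q \<noteq> {}" by (auto simp: Q_def)
  have D_le: "D z w \<le> L * norm z" if "w \<in> Q" for z w
  proof -
    have "f (fst w + snd w *\<^sub>R z) - f (fst w) \<le> L * (snd w * norm z)"
      using lipschitz_onD[OF L, of "fst w + snd w *\<^sub>R z" "fst w"] that
      by (auto simp: dist_norm Q_def)
    then show ?thesis using that by (auto simp: D_def Q_def field_simps)
  qed
  have bdd: "bdd_above (D z ` Q)" for z
    using D_le by (intro bdd_aboveI2) auto
  have q_ge: "D z w \<le> q z" if "w \<in> Q" for z w
    unfolding q_def using that by (intro cSUP_upper bdd)
  have q_le: "q z \<le> b" if "\<And>w. w \<in> Q \<Longrightarrow> D z w \<le> b" for z b
    unfolding q_def using that Qne by (intro cSUP_least) auto
  have "sublinear q"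
  proof (rule sublinearI)
    fix y z
    show "q (y + z) \<le> q y + q z"
    proof (rule q_le)
      fix w assume w: "w \<in> Q"
      \<comment> \<open>Walking along \<open>y\<close> first and measuring the
        \<open>z\<close>-quotient from the new base point makes the increments telescope.\<close>
      have "D (y + z) w = D y w + D z (fst w + snd w *\<^sub>R y, snd w)"
        by (simp add: D_def algebra_simps add_divide_distrib diff_divide_distrib)
      also have "\<dots> \<le> q y + q z"
        using w by (intro add_mono q_ge) (auto simp: Q_def)
      finally show "D (y + z) w \<le> q y + q z" .
    qed
  next
    fix s :: real and z assume s: "0 < s"
    show "q (s *\<^sub>R z) \<le> s * q z"
    proof (rule q_le)
      fix w assume w: "w \<in> Q"
      \<comment> \<open>The factor \<open>s\<close> is absorbed into the step length.\<close>
      have "D (s *\<^sub>R z) w = s * D z (fst w, snd w * s)"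
        using s by (simp add: D_def)
      also have "\<dots> \<le> s * q z"
        using w s by (intro mult_left_mono q_ge) (auto simp: Q_def)
      finally show "D (s *\<^sub>R z) w \<le> s * q z" .
    qed
  qed
  then obtain g where g: "linear g" "\<And>z. g z \<le> q z" "g (x1 - x2) = q (x1 - x2)"
    using hahn_banach_sublinear[of q "x1 - x2"] by metis
  have g_le: "g z \<le> L * norm z" for z
    using g(2) q_le D_le by (meson order_trans)
  have "norm (g z) \<le> norm z * L" for z
    using g_le[of z] g_le[of "- z"] by (simp add: linear_neg[OF g(1)] abs_le_iff mult.commute)
  then have bl: "bounded_linear g"
    using g(1) by (meson bounded_linear.intro bounded_linear_axioms.intro)
  define u where "u = (x1 - x2) /\<^sub>R norm (x1 - x2)"
  \<comment> \<open>Base point \<open>x2\<close> and step length 1 recover the given increment of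
    \<open>f\<close>.\<close>
  have "f x1 - f x2 \<le> g (x1 - x2)"
    using q_ge[of "(x2, 1)" "x1 - x2"] g(3) by (simp add: D_def Q_def)
  then have u: "\<alpha> < g u"
    using x12 unfolding u_def linear_cmul[OF g(1)] by (simp add: field_simps)
  show thesis
  proof (rule that[OF bl _ u])
    show "norm u = 1" using x12(1) by (simp add: u_def)
    fix y assume y: "norm y = 1" "\<alpha> < g y"
    \<comment> \<open>A supremum strictly above \<open>\<alpha>\<close> is witnessed by a single
      quotient; as \<open>norm y = 1\<close>, the two end points of its step exhibit
      \<open>y\<close> as an element of \<open>S\<close>.\<close>
    then have "\<alpha> < (SUP w\<in>Q. D y w)" using g(2)[of y] by (simp add: q_def)
    then obtain w where w: "w \<in> Q" "\<alpha> < D y w"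
      using less_cSUP_iff[OF Qne bdd] by blast
    then show "y \<in> S"
      unfolding S using y(1)
      by (intro CollectI exI[of _ "fst w + snd w *\<^sub>R y"] exI[of _ "fst w"])
        (auto simp: D_def Q_def)
  qed
qed

section \<open>The Daugavet equation and linear slices\<close>

text \<open>The operator \<open>T\<close> has rank and norm one, so adding it to the identity gives
  norm 2. A vector nearly attaining this also nearly attains the norm of \<open>G\<close>; after a
  rotation its image under \<open>T\<close> is close to \<open>x\<close>. A general scalar field
  serves the real and the complex case at once.\<close>

lemma daugavet_functional:
  fixes s :: "'k::real_normed_field \<Rightarrow> 'a::banach \<Rightarrow> 'a" and G :: "'a \<Rightarrow> 'k"
  assumes s: "banach_over s" and D: "daugavet_property s"
    and G: "Vector_Spaces.linear s (*) G"
    and G_le: "\<And>z. norm (G z) \<le> norm z" and G_onorm: "onorm G = 1"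
    and x: "norm x = 1" and \<eta>: "0 < \<eta>" "\<eta> < 1"
  obtains y r where "norm y = 1" "G y = of_real r" "1 - \<eta> < r" "2 - 2 * \<eta> < norm (x + y)"
proof -
  interpret banach_over s by fact
  interpret G: Vector_Spaces.linear s "(*)" G by fact
  define T where "T z = s (G z) x" for z
  have T_norm: "norm (T z) = norm (G z)" for z
    by (simp add: T_def norm_scale x)
  have "onorm T = 1"
    using G_onorm by (simp add: onorm_def T_norm)
  moreover have "bounded_operator s T"
    unfolding bounded_operator_def
  proof (intro conjI exI allI)
    show "Vector_Spaces.linear s s T"
      by unfold_locales (simp_all add: T_def G.add G.scale algebra_simps)
    show "norm (T z) \<le> 1 * norm z" for z
      using G_le by (simp add: T_norm)
  qed
  moreover have "rank_one s T"
  proof -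
    obtain z where z: "G z \<noteq> 0"
    proof (rule ccontr)
      assume "\<not> thesis"
      then have "G = (\<lambda>_. 0)" using that by blast
      then show False using G_onorm by (simp add: onorm_zero)
    qed
    have "range T = span {x}"
    proof -
      have "s c x = T (s (c / G z) z)" for c
        using z by (simp add: T_def G.scale)
      then have "s c x \<in> range T" for c by (metis rangeI)
      then show ?thesis by (auto simp: span_singleton T_def[abs_def])
    qed
    moreover have "independent {x}" using x by (auto simp: dependent_single)
    ultimately show ?thesis
      unfolding rank_one_def by (simp add: dim_eq_card_independent)
  qed
  ultimately have "onorm (\<lambda>z. z + T z) = 2"
    using D by (simp add: daugavet_property_def)
  then have "\<not> (\<forall>z. norm (z + T z) \<le> (2 - \<eta>) * norm z)"
    using onorm_bound[of "2 - \<eta>" "\<lambda>z. z + T z"] \<eta> by auto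
  then obtain z where z: "(2 - \<eta>) * norm z < norm (z + T z)"
    by (auto simp: not_le)
  have z0: "z \<noteq> 0"
    using z by (auto simp: T_def G.zero)
  have "norm (z + T z) \<le> norm z + norm (G z)"
    using norm_triangle_ineq[of z "T z"] by (simp add: T_norm)
  then have Gz: "(1 - \<eta>) * norm z < norm (G z)"
    using z by (simp add: algebra_simps)
  then have Gz0: "G z \<noteq> 0" using \<eta> z0
    by (metis diff_gt_0_iff_gt less_asym mult_pos_pos norm_zero zero_less_norm_iff)
  \<comment> \<open>This scalar normalises \<open>z\<close> and rotates its image under
    \<open>G\<close> onto the positive real axis.\<close>
  define \<omega> where "\<omega> = of_real (norm (G z) / norm z) / G z"
  define y where "y = s \<omega> z"
  define r where "r = norm (G z) / norm z"
  have n\<omega>: "norm \<omega> = 1 / norm z"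
    using Gz0 by (simp add: \<omega>_def norm_divide norm_mult)
  show thesis
  proof
    show y: "norm y = 1"
      using z0 by (simp add: y_def norm_scale n\<omega>)
    show Gy: "G y = of_real r"
      using Gz0 by (simp add: y_def G.scale \<omega>_def r_def)
    show r: "1 - \<eta> < r"
      using Gz z0 by (simp add: r_def field_simps)
    have r1: "r \<le> 1"
      using G_le[of z] z0 by (simp add: r_def)
    have "y + T y = s \<omega> (z + T z)"
      by (simp add: y_def T_def G.scale algebra_simps)
    then have "norm (y + T y) = norm (z + T z) / norm z"
      by (simp add: norm_scale n\<omega>)
    then have 1: "2 - \<eta> < norm (y + T y)"
      using z z0 by (simp add: pos_less_divide_eq)
    \<comment> \<open>\<open>T y\<close> is \<open>r\<close> times \<open>x\<close>, and replacing
      it by \<open>x\<close> costs \<open>1 - r < \<eta>\<close>: the second \<open>\<eta>\<close>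
      in the bound.\<close>
    have "y + T y = (x + y) - (1 - r) *\<^sub>R x"
      by (simp add: T_def Gy scale_of_real algebra_simps)
    then have "norm (y + T y) \<le> norm (x + y) + norm ((1 - r) *\<^sub>R x)"
      by (metis norm_triangle_ineq4)
    then show "2 - 2 * \<eta> < norm (x + y)"
      using 1 r r1 x by simp
  qed
qed

lemma daugavet_real_functional:
  fixes g :: "'a::banach \<Rightarrow> real"
  assumes D: "daugavet_property (scaleR :: real \<Rightarrow> 'a \<Rightarrow> 'a)"
    and g: "bounded_linear g" and g1: "onorm g = 1"
    and x: "norm x = 1" and \<eta>: "0 < \<eta>" "\<eta> < 1"
  obtains y where "norm y = 1" "1 - \<eta> < g y" "2 - 2 * \<eta> < norm (x + y)"
proof -
  have "Vector_Spaces.linear scaleR (*) g"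
    using bounded_linear.linear[OF g] by (simp add: linear_def real_scaleR_def[abs_def])
  moreover have "norm (g z) \<le> norm z" for z
    using onorm[OF g, of z] by (simp add: g1)
  ultimately show thesis
    using daugavet_functional[OF banach_over_scaleR D _ _ g1 x \<eta>] that by (metis of_real_eq_id id_apply)
qed

text \<open>The functional \<open>g\<close> is the real part of a complex-linear \<open>G\<close> of
  the same norm. The point supplied by \<open>daugavet_functional\<close> has a real value
  \<open>G y\<close>, which is therefore \<open>g y\<close>.\<close>

lemma daugavet_complex_functional:
  fixes g :: "'a::banach \<Rightarrow> real" and s :: "complex \<Rightarrow> 'a \<Rightarrow> 'a"
  assumes s: "banach_over s" and D: "daugavet_property s"
    and g: "bounded_linear g" and g1: "onorm g = 1"
    and x: "norm x = 1" and \<eta>: "0 < \<eta>" "\<eta> < 1"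
  obtains y where "norm y = 1" "1 - \<eta> < g y" "2 - 2 * \<eta> < norm (x + y)"
proof -
  interpret banach_over s by fact
  interpret g: bounded_linear g by fact
  define G where "G z = Complex (g z) (- g (s \<i> z))" for z
  have s_eq: "s c z = Re c *\<^sub>R z + Im c *\<^sub>R s \<i> z" for c z
  proof -
    have "s c z = s (of_real (Re c) + of_real (Im c) * \<i>) z"
      by (simp add: complex_eq[symmetric] mult.commute)
    also have "\<dots> = Re c *\<^sub>R z + Im c *\<^sub>R s \<i> z"
      by (simp only: scale_left_distrib scale_scale[symmetric] scale_of_real)
    finally show ?thesis .
  qed
  have ii: "s \<i> (s \<i> z) = - z" for z by simp
  have lin: "Vector_Spaces.linear s (*) G"
  proof (unfold_locales)
    fix c z
    have "s \<i> (s c z) = Re c *\<^sub>R s \<i> z - Im c *\<^sub>R z"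
      using s_eq[of c "s \<i> z"] by (simp only: scale_left_commute[of \<i> c]) (simp add: ii)
    then show "G (s c z) = c * G z"
      by (simp add: G_def s_eq[of c z] complex_eq_iff g.add g.diff g.scaleR)
  qed (simp_all add: G_def g.add scale_right_distrib complex_eq_iff algebra_simps)
  interpret G: Vector_Spaces.linear s "(*)" G by fact
  have g_le: "\<bar>g z\<bar> \<le> norm z" for z
    using onorm[OF g, of z] by (simp add: g1)
  have G_le: "norm (G z) \<le> norm z" for z
  proof (cases "G z = 0")
    case False
    \<comment> \<open>Rotating \<open>z\<close> by a unimodular scalar makes the value of
      \<open>G\<close> real, so the modulus of \<open>G z\<close> is a value of
      \<open>g\<close>.\<close>
    define \<omega> where "\<omega> = of_real (norm (G z)) / G z"
    have "G (s \<omega> z) = of_real (norm (G z))"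
      using False by (simp add: G.scale \<omega>_def)
    then have "norm (G z) = g (s \<omega> z)"
      by (simp add: G_def complex_eq_iff)
    also have "\<dots> \<le> norm (s \<omega> z)"
      using g_le[of "s \<omega> z"] by linarith
    also have "\<dots> = norm z"
      using False by (simp add: norm_scale \<omega>_def norm_divide)
    finally show ?thesis .
  qed simp
  have bl: "bounded_linear G"
  proof (rule bounded_linear_intro)
    show "G (y + z) = G y + G z" for y z by (rule G.add)
    show "G (t *\<^sub>R z) = t *\<^sub>R G z" for t z
      using G.scale[of "of_real t" z] by (simp add: scale_of_real scaleR_conv_of_real)
    show "norm (G z) \<le> norm z * 1" for z using G_le by simp
  qed
  have "onorm G = 1"
  proof (rule antisym)
    show "onorm G \<le> 1" using G_le by (intro onorm_bound) auto
    have "onorm g \<le> onorm G"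
    proof (rule onorm_bound[OF onorm_pos_le[OF bl]])
      fix z
      have "norm (g z) \<le> norm (G z)"
        using abs_Re_le_cmod[of "G z"] by (simp add: G_def)
      also have "\<dots> \<le> onorm G * norm z" by (rule onorm[OF bl])
      finally show "norm (g z) \<le> onorm G * norm z" .
    qed
    then show "1 \<le> onorm G" by (simp add: g1)
  qed
  then obtain y r where "norm y = 1" "G y = of_real r" "1 - \<eta> < r" "2 - 2 * \<eta> < norm (x + y)"
    using daugavet_functional[OF s D lin G_le _ x \<eta>] by metis
  moreover from this(2) have "g y = r" by (simp add: G_def complex_eq_iff)
  ultimately show thesis using that by blast
qed

theorem corollary2p6:
  fixes S :: "'a::banach set" and \<epsilon> :: real and x :: 'a
  assumes daugavet:
      "daugavet_property (scaleR :: real \<Rightarrow> 'a \<Rightarrow> 'a) \<or>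
       (\<exists>s :: complex \<Rightarrow> 'a \<Rightarrow> 'a. banach_over s \<and> daugavet_property s)"
    and "\<epsilon> > 0"
    and "lip_slice S"
    and "x \<in> sphere 0 1"
  shows "\<exists>y\<in>S. norm (x + y) > 2 - \<epsilon>"
proof -
  have x: "norm x = 1" using assms(4) by simp
  obtain g :: "'a \<Rightarrow> real" and \<alpha> u where g: "bounded_linear g" and u: "norm u = 1" "\<alpha> < g u"
    and slice: "\<And>y. norm y = 1 \<Longrightarrow> \<alpha> < g y \<Longrightarrow> y \<in> S"
    using lip_slice_contains_slice[OF assms(3)] by metis
  define c where "c = onorm g"
  have g_le: "\<bar>g z\<bar> \<le> c * norm z" for z
    using onorm[OF g, of z] by (simp add: c_def)
  show ?thesis
  proof (cases "c = 0")
    \<comment> \<open>If \<open>g\<close> vanishes then \<open>\<alpha> < 0\<close>, the slice is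
      the whole sphere, and \<open>x\<close> itself serves as \<open>y\<close>.\<close>
    case True
    then have "g z = 0" for z using g_le[of z] by simp
    then have "x \<in> S" using slice[OF x] u by simp
    moreover have "norm (x + x) = 2"
      using x by (simp add: scaleR_2[symmetric])
    ultimately show ?thesis using \<open>\<epsilon> > 0\<close> by force
  next
    case False
    then have c: "0 < c" using onorm_pos_le[OF g] by (simp add: c_def)
    have \<alpha>: "\<alpha> < c" using g_le[of u] u by simp
    define h where "h z = g z / c" for z
    have h: "bounded_linear h"
      unfolding h_def using bounded_linear_compose[OF bounded_linear_divide g] .
    have h1: "onorm h = 1"
      using onorm_scaleR[OF g, of "1 / c"] c by (simp add: h_def[abs_def] c_def)
    \<comment> \<open>\<open>\<epsilon> / 2\<close> yields the norm bound,
      \<open>(c - \<alpha>) / c\<close> lifts \<open>g y\<close> above \<open>\<alpha>\<close>, and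
      \<open>1 / 2\<close> ensures \<open>\<eta> < 1\<close>.\<close>
    define \<eta> where "\<eta> = min (\<epsilon> / 2) (min ((c - \<alpha>) / c) (1 / 2))"
    have "\<eta> \<le> \<epsilon> / 2" "\<eta> \<le> 1 / 2" "\<eta> \<le> (c - \<alpha>) / c"
      unfolding \<eta>_def by linarith+
    moreover have "0 < \<eta>"
      using c \<alpha> \<open>\<epsilon> > 0\<close> by (simp add: \<eta>_def)
    ultimately have \<eta>: "0 < \<eta>" "\<eta> < 1" "2 * \<eta> \<le> \<epsilon>" "\<eta> \<le> (c - \<alpha>) / c"
      by linarith+
    obtain y where y: "norm y = 1" "1 - \<eta> < h y" "2 - 2 * \<eta> < norm (x + y)"
      using daugavet daugavet_real_functional[OF _ h h1 x \<eta>(1,2)]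
        daugavet_complex_functional[OF _ _ h h1 x \<eta>(1,2)] by metis
    have "\<eta> * c \<le> c - \<alpha>" using \<eta>(4) c by (simp add: field_simps)
    moreover have "c - \<eta> * c < g y" using y(2) c by (simp add: h_def field_simps)
    ultimately have "y \<in> S" using slice[OF y(1)] by linarith
    then show ?thesis using y(3) \<eta>(3) by force
  qed
qed

end
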